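(* Let $\mathfrak{L}$ be a finite-dimensional nilpotent left Leibniz algebra over a field $\mathbb{F}$, and let $M$ be a finite-dimensional $\mathfrak{L}$-bimodule. If every composition factor of $M$ is non-trivial, then $$\mathrm{HL}^n(\mathfrak{L},M)\cong\begin{cases}M_0&\text{if }n=0,\\0&\text{if }n\ge 1.\end{cases}$$ Moreover, if $M$ is symmetric, then $\mathrm{HL}^n(\mathfrak{L},M)=0$ for every non-negative integer $n$.
   Context: A left Leibniz algebra over a field $\mathbb{F}$ is an $\mathbb{F}$-vector space $\mathfrak{L}$ with a bilinear multiplication satisfying $x(yz)=(xy)z+y(xz)$ for all $x,y,z\in\mathfrak{L}$. It is nilpotent if there is a positive integer $n$ such that any product of $n$ elements of $\mathfrak{L}$, no matter how associated, is zero. An $\mathfrak{L}$-bimodule is an $\mathbb{F}$-vector space $M$ with bilinear left and right actions of $\mathfrak{L}$ such that $(xy)\cdot m=x\cdot(y\cdot m)-y\cdot(x\cdot m)$, $(x\cdot m)\cdot y=x\cdot(m\cdot y)-m\cdot(xy)$, and $(m\cdot x)\cdot y=m\cdot(xy)-x\cdot(m\cdot y)$ for all $m\in M$, $x,y\in\mathfrak{L}$. $M$ is symmetric if $m\cdot x=-x\cdot m$ for all $x\in\mathfrak{L}$, $m\in M$; $M$ is trivial if $x\cdot m=0=m\cdot x$ for all $x,m$. Composition factors are taken in the category of $\mathfrak{L}$-bimodules. The anti-symmetric kernel of $M$ is the subspace (in fact subbimodule) $M_0:=\langle x\cdot m+m\cdot x\mid x\in\mathfrak{L},m\in M\rangle_{\mathbb{F}}$.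 Leibniz cohomology: for $n\ge 0$ let $\mathrm{CL}^n(\mathfrak{L},M):=\mathrm{Hom}_{\mathbb{F}}(\mathfrak{L}^{\otimes n},M)$ and $\mathrm{d}^n:\mathrm{CL}^n(\mathfrak{L},M)\to\mathrm{CL}^{n+1}(\mathfrak{L},M)$, $$(\mathrm{d}^nf)(x_1\otimes\dots\otimes x_{n+1})=\sum_{j=1}^n(-1)^{j+1}x_j\cdot f(x_1\otimes\dots\otimes\hat{x}_j\otimes\dots\otimes x_{n+1})+(-1)^{n+1}f(x_1\otimes\dots\otimes x_n)\cdot x_{n+1}+\sum_{1\le i<j\le n+1}(-1)^if(x_1\otimes\dots\otimes\hat{x}_i\otimes\dots\otimes x_{j-1}\otimes x_ix_j\otimes x_{j+1}\otimes\dots\otimes x_{n+1}).$$ This is a cochain complex, and $\mathrm{HL}^n(\mathfrak{L},M):=\operatorname{Ker}(\mathrm{d}^n)/\operatorname{Im}(\mathrm{d}^{n-1})$ with $\mathrm{d}^{-1}:=0$. *)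

theory Defs
  imports Complex_Main "HOL-Library.Function_Algebras" "HOL-Library.Set_Algebras"
begin

text \<open>
  The algebra and the bimodule are vector spaces on whole types. Subquotients of them (cohomology
  spaces, composition factors) live on sets of cosets, so they are packed into records
  with an explicit carrier.
\<close>

record ('f, 'b) vspace =
  vs_carrier :: "'b set"
  vs_zero :: 'b
  vs_add :: "'b \<Rightarrow> 'b \<Rightarrow> 'b"
  vs_scale :: "'f \<Rightarrow> 'b \<Rightarrow> 'b"

definition vspace_iso :: "('f, 'a, 'x) vspace_scheme \<Rightarrow> ('f, 'b, 'y) vspace_scheme \<Rightarrow> bool" where
  "vspace_iso V W \<longleftrightarrow> (\<exists>\<phi>. bij_betw \<phi> (vs_carrier V) (vs_carrier W) \<and>
     (\<forall>u\<in>vs_carrier V. \<forall>v\<in>vs_carrier V. \<phi> (vs_add V u v) = vs_add W (\<phi> u) (\<phi> v)) \<and>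
     (\<forall>c. \<forall>v\<in>vs_carrier V. \<phi> (vs_scale V c v) = vs_scale W c (\<phi> v)))"

definition vspace_is_zero :: "('f, 'b, 'x) vspace_scheme \<Rightarrow> bool" where
  "vspace_is_zero V \<longleftrightarrow> vs_carrier V = {vs_zero V}"

definition subspace_vspace :: "('f \<Rightarrow> 'b \<Rightarrow> 'b) \<Rightarrow> 'b::ab_group_add set \<Rightarrow> ('f, 'b) vspace" where
  "subspace_vspace scl U =
     \<lparr>vs_carrier = U, vs_zero = 0, vs_add = (+), vs_scale = scl\<rparr>"

text \<open>
  In the quotient \<open>W / U\<close> cosets are added as sets. The summand \<open>U\<close> in the scalar multiplication
  is needed for the scalar \<open>0\<close>, as \<open>0 (w + U) = {0}\<close> elementwise; it is likewise needed for the
  images of cosets under the actions in \<open>quotient_bimodule\<close> below.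
\<close>

definition quotient_vspace ::
    "('f \<Rightarrow> 'b \<Rightarrow> 'b) \<Rightarrow> 'b::ab_group_add set \<Rightarrow> 'b set \<Rightarrow> ('f, 'b set) vspace" where
  "quotient_vspace scl W U =
     \<lparr>vs_carrier = (\<lambda>w. w +o U) ` W, vs_zero = U, vs_add = (+),
      vs_scale = (\<lambda>c A. scl c ` A + U)\<rparr>"

record ('f, 'l, 'b) bimodule = "('f, 'b) vspace" +
  bm_left :: "'l \<Rightarrow> 'b \<Rightarrow> 'b"
  bm_right :: "'b \<Rightarrow> 'l \<Rightarrow> 'b"

definition is_subbimodule :: "'b set \<Rightarrow> ('f, 'l, 'b) bimodule \<Rightarrow> bool" where
  "is_subbimodule S B \<longleftrightarrow> S \<subseteq> vs_carrier B \<and> vs_zero B \<in> S \<and>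
     (\<forall>u\<in>S. \<forall>v\<in>S. vs_add B u v \<in> S) \<and>
     (\<forall>c. \<forall>v\<in>S. vs_scale B c v \<in> S) \<and>
     (\<forall>x. \<forall>v\<in>S. bm_left B x v \<in> S \<and> bm_right B v x \<in> S)"

definition simple_bimodule :: "('f, 'l, 'b) bimodule \<Rightarrow> bool" where
  "simple_bimodule B \<longleftrightarrow> \<not> vspace_is_zero B \<and>
     (\<forall>S. is_subbimodule S B \<longrightarrow> S = {vs_zero B} \<or> S = vs_carrier B)"

definition trivial_bimodule :: "('f, 'l, 'b) bimodule \<Rightarrow> bool" where
  "trivial_bimodule B \<longleftrightarrow>
     (\<forall>x. \<forall>v\<in>vs_carrier B. bm_left B x v = vs_zero B \<and> bm_right B v x = vs_zero B)"

locale leibniz_algebra =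
  vector_space scaleL
  for scaleL :: "'f::field \<Rightarrow> 'l::ab_group_add \<Rightarrow> 'l" +
  fixes mult :: "'l \<Rightarrow> 'l \<Rightarrow> 'l"
  assumes linear_mult_left: "\<And>y. Vector_Spaces.linear scaleL scaleL (\<lambda>x. mult x y)"
    and linear_mult_right: "\<And>x. Vector_Spaces.linear scaleL scaleL (\<lambda>y. mult x y)"
    and left_leibniz: "\<And>x y z. mult x (mult y z) = mult (mult x y) z + mult y (mult x z)"
begin

text \<open>\<open>is_product n z\<close>: \<open>z\<close> is a product of \<open>n\<close> elements with some bracketing.\<close>

inductive is_product :: "nat \<Rightarrow> 'l \<Rightarrow> bool" where
  single: "is_product 1 x"
| product: "is_product m x \<Longrightarrow> is_product n y \<Longrightarrow> is_product (m + n) (mult x y)"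

definition nilpotent :: bool where
  "nilpotent \<longleftrightarrow> (\<exists>n>0. \<forall>z. is_product n z \<longrightarrow> z = 0)"

end

definition omit :: "nat \<Rightarrow> 'a list \<Rightarrow> 'a list" where
  "omit i xs = take i xs @ drop (Suc i) xs"

locale leibniz_bimodule =
  L: leibniz_algebra scaleL mult + M: vector_space scaleM
  for scaleL :: "'f::field \<Rightarrow> 'l::ab_group_add \<Rightarrow> 'l"
    and mult :: "'l \<Rightarrow> 'l \<Rightarrow> 'l"
    and scaleM :: "'f \<Rightarrow> 'm::ab_group_add \<Rightarrow> 'm" +
  fixes lact :: "'l \<Rightarrow> 'm \<Rightarrow> 'm"
    and ract :: "'m \<Rightarrow> 'l \<Rightarrow> 'm"
  assumes linear_lact_algebra: "\<And>m. Vector_Spaces.linear scaleL scaleM (\<lambda>x. lact x m)"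
    and linear_lact_module: "\<And>x. Vector_Spaces.linear scaleM scaleM (\<lambda>m. lact x m)"
    and linear_ract_algebra: "\<And>m. Vector_Spaces.linear scaleL scaleM (\<lambda>x. ract m x)"
    and linear_ract_module: "\<And>x. Vector_Spaces.linear scaleM scaleM (\<lambda>m. ract m x)"
    and LLM: "\<And>x y m. lact (mult x y) m = lact x (lact y m) - lact y (lact x m)"
    and LML: "\<And>x y m. ract (lact x m) y = lact x (ract m y) - ract m (mult x y)"
    and MLL: "\<And>x y m. ract (ract m x) y = ract m (mult x y) - lact x (ract m y)"
begin

definition symmetric :: bool where
  "symmetric \<longleftrightarrow> (\<forall>x m. ract m x = - lact x m)"

definition antisymmetric_kernel :: "'m set" where
  "antisymmetric_kernel = M.span {lact x m + ract m x | x m. True}"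

definition self_bimodule :: "('f, 'l, 'm) bimodule" where
  "self_bimodule =
     \<lparr>vs_carrier = UNIV, vs_zero = 0, vs_add = (+), vs_scale = scaleM,
      bm_left = lact, bm_right = ract\<rparr>"

definition quotient_bimodule :: "'m set \<Rightarrow> 'm set \<Rightarrow> ('f, 'l, 'm set) bimodule" where
  "quotient_bimodule U V =
     \<lparr>vs_carrier = (\<lambda>u. u +o V) ` U, vs_zero = V, vs_add = (+),
      vs_scale = (\<lambda>c A. scaleM c ` A + V),
      bm_left = (\<lambda>x A. lact x ` A + V), bm_right = (\<lambda>A x. (\<lambda>m. ract m x) ` A + V)\<rparr>"

definition composition_series :: "'m set list \<Rightarrow> bool" where
  "composition_series Us \<longleftrightarrow> Us \<noteq> [] \<and> hd Us = {0} \<and> last Us = UNIV \<and>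
     (\<forall>U\<in>set Us. is_subbimodule U self_bimodule) \<and>
     (\<forall>i. Suc i < length Us \<longrightarrow>
        Us ! i \<subseteq> Us ! Suc i \<and> simple_bimodule (quotient_bimodule (Us ! Suc i) (Us ! i)))"

definition composition_factors :: "('f, 'l, 'm set) bimodule set" where
  "composition_factors =
     {quotient_bimodule (Us ! Suc i) (Us ! i) | Us i. composition_series Us \<and> Suc i < length Us}"

text \<open>
  A linear map from the \<open>n\<close>-th tensor power is given as an \<open>n\<close>-linear map, defined on the lists of
  length \<open>n\<close> and extended by \<open>0\<close> to all other lists. The arguments \<open>x\<^sub>1, \<dots>, x\<^sub>n\<close> are the list entries
  with indices \<open>0, \<dots>, n - 1\<close>, which shifts the signs in the coboundary.
\<close>

definition CL :: "nat \<Rightarrow> ('l list \<Rightarrow> 'm) set" where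
  "CL n = {f. (\<forall>xs. length xs \<noteq> n \<longrightarrow> f xs = 0) \<and>
     (\<forall>xs i. length xs = n \<longrightarrow> i < n \<longrightarrow>
        Vector_Spaces.linear scaleL scaleM (\<lambda>x. f (xs[i := x])))}"

definition scaleCL :: "'f \<Rightarrow> ('l list \<Rightarrow> 'm) \<Rightarrow> 'l list \<Rightarrow> 'm" where
  "scaleCL c f = (\<lambda>xs. scaleM c (f xs))"

definition coboundary :: "nat \<Rightarrow> ('l list \<Rightarrow> 'm) \<Rightarrow> 'l list \<Rightarrow> 'm" where
  "coboundary n f = (\<lambda>xs. if length xs = Suc n then
       (\<Sum>j<n. scaleM ((-1) ^ j) (lact (xs ! j) (f (omit j xs))))
       + scaleM ((-1) ^ Suc n) (ract (f (omit n xs)) (xs ! n))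
       + (\<Sum>j\<le>n. \<Sum>i<j. scaleM ((-1) ^ Suc i) (f (omit i (xs[j := mult (xs ! i) (xs ! j)]))))
     else 0)"

definition cocycles :: "nat \<Rightarrow> ('l list \<Rightarrow> 'm) set" where
  "cocycles n = {f \<in> CL n. coboundary n f = 0}"

definition coboundaries :: "nat \<Rightarrow> ('l list \<Rightarrow> 'm) set" where
  "coboundaries n = (case n of 0 \<Rightarrow> {0} | Suc k \<Rightarrow> coboundary k ` CL k)"

definition HL :: "nat \<Rightarrow> ('f, ('l list \<Rightarrow> 'm) set) vspace" where
  "HL n = quotient_vspace scaleCL (cocycles n) (coboundaries n)"

end

end

theory Submission
  imports Defs
begin

text \<open>
  For \<open>x\<close> in the algebra let \<open>\<theta>\<^sub>x\<close> be the Lie derivative on cochains and \<open>\<iota>\<^sub>x\<close> the insertion of \<open>x\<close> as first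
  argument. Cartan's formula \<open>\<theta>\<^sub>x = \<iota>\<^sub>x d + d \<iota>\<^sub>x\<close> holds in positive degrees, so \<open>\<theta>\<^sub>x\<close> maps cocycles to
  coboundaries; in degree \<open>0\<close> it maps them into the anti-symmetric kernel.
  On a non-trivial simple subquotient \<open>U / V\<close> some \<open>x\<close> acts injectively: take \<open>x\<close> to be a product of
  as many factors as possible among those acting non-trivially. Then \<open>x\<close> commutes with the whole
  action on \<open>U / V\<close>, and Schur's argument applies.
  As left multiplication by \<open>x\<close> is nilpotent, \<open>\<theta>\<^sub>x\<close> is injective, hence bijective, on the cochains with
  values in \<open>U / V\<close>. A cocycle with values in \<open>U\<close> therefore differs from some \<open>\<theta>\<^sub>x w\<close>, with \<open>w\<close> a
  cocycle, by a cocycle with values in \<open>V\<close>, and one descends along a composition series.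
\<close>

section \<open>Cosets and Fitting's lemma\<close>

text \<open>The image of a coset may be smaller than a coset, for instance when \<phi> is zero;
  adding \<open>V\<close> fills it up. All operations on a quotient bimodule have this form, so this
  one computation reduces them to representatives.\<close>

lemma coset_image:
  fixes V :: "'a::ab_group_add set"
  assumes "additive \<phi>" and "\<phi> ` V \<subseteq> V" and "0 \<in> V" and "\<And>u v. u \<in> V \<Longrightarrow> v \<in> V \<Longrightarrow> u + v \<in> V"
  shows "\<phi> ` (a +o V) + V = \<phi> a +o V"
proof
  show "\<phi> ` (a +o V) + V \<subseteq> \<phi> a +o V"
    using assms(2,4)
    by (fastforce simp: elt_set_plus_def set_plus_def additive.add[OF assms(1)] add.assoc)
  show "\<phi> a +o V \<subseteq> \<phi> ` (a +o V) + V"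
  proof
    fix z assume "z \<in> \<phi> a +o V"
    then obtain v where v: "v \<in> V" "z = \<phi> a + v"
      by (auto simp: elt_set_plus_def)
    have "\<phi> a \<in> \<phi> ` (a +o V)"
      using assms(3) by (force simp: elt_set_plus_def)
    then show "z \<in> \<phi> ` (a +o V) + V"
      using v by (metis set_plus_intro)
  qed
qed

lemma coset_eq_iff:
  fixes V :: "'a::ab_group_add set"
  assumes "0 \<in> V" and "\<And>u v. u \<in> V \<Longrightarrow> v \<in> V \<Longrightarrow> u + v \<in> V" and "\<And>v. v \<in> V \<Longrightarrow> - v \<in> V"
  shows "a +o V = b +o V \<longleftrightarrow> a - b \<in> V"
proof
  assume "a +o V = b +o V"
  then show "a - b \<in> V"
    using assms(1) by (metis add.right_neutral set_minus_plus set_plus_intro2)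
next
  assume ab: "a - b \<in> V"
  have "c +o V \<subseteq> d +o V" if "c - d \<in> V" for c d
  proof
    fix z assume "z \<in> c +o V"
    then have "z - c \<in> V"
      by (simp add: set_minus_plus)
    then have "z - d \<in> V"
      using assms(2)[OF \<open>z - c \<in> V\<close> that] by simp
    then show "z \<in> d +o V"
      by (simp add: set_minus_plus)
  qed
  then show "a +o V = b +o V"
    using ab assms(3)[OF ab] by (simp add: subset_antisym)
qed

section \<open>Fitting's lemma for an orbit in a finite-dimensional span\<close>

context vector_space
begin

text \<open>Otherwise no iterate lies in the span of the later ones, and the first
  \<open>Suc (card T)\<close> iterates are independent, which is too many for
  \<open>span T\<close>.\<close>

lemma iterate_in_span_of_later_iterates:
  assumes "finite T" and orbit: "\<And>k. (\<theta> ^^ k) f \<in> span T"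
  shows "\<exists>r. (\<theta> ^^ r) f \<in> span ((\<lambda>k. (\<theta> ^^ k) f) ` {r<..})"
proof (rule ccontr)
  let ?g = "\<lambda>k. (\<theta> ^^ k) f"
  assume "\<not> ?thesis"
  then have new: "?g r \<notin> span (?g ` {r<..})" for r
    by blast
  \<comment> \<open>The set grows downwards from index \<open>N - 1\<close>, since
    \<open>new\<close> compares an iterate with later ones only. The cardinality is carried along to
    know that the iterates are distinct.\<close>
  have indep: "independent (?g ` {N - m..<N}) \<and> card (?g ` {N - m..<N}) = m" if "m \<le> N" for N m
    using that
  proof (induction m)
    case (Suc m)
    have split: "{N - Suc m..<N} = insert (N - Suc m) {N - m..<N}"
      using Suc.prems by auto
    have "?g ` {N - m..<N} \<subseteq> ?g ` {N - Suc m<..}"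
      using Suc.prems by (intro image_mono) auto
    from span_mono[OF this] have "?g (N - Suc m) \<notin> span (?g ` {N - m..<N})"
      by (rule contra_subsetD) (rule new)
    moreover from span_superset this have "?g (N - Suc m) \<notin> ?g ` {N - m..<N}"
      by (rule contra_subsetD)
    moreover have "independent (?g ` {N - m..<N})" "card (?g ` {N - m..<N}) = m"
      using Suc by simp_all
    ultimately show ?case
      unfolding split image_insert by (simp add: independent_insertI)
  qed (use independent_empty in auto)
  let ?N = "Suc (card T)"
  have "independent (?g ` {0..<?N})" "card (?g ` {0..<?N}) = ?N"
    using indep[of ?N ?N] by auto
  moreover have "?g ` {0..<?N} \<subseteq> span T"
    using orbit by blast
  ultimately show False
    using independent_span_bound[OF assms(1)] by fastforce
qed

text \<open>Fitting decomposition of the single vector \<open>f\<close>: up to a part killed by a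
  power of \<theta>, it lies in the image of \<theta>. That \<open>w\<close> comes from the span of
  the orbit matters later, because it then inherits every property of \<open>f\<close> that defines
  a \<theta>-invariant subspace.\<close>

lemma fitting_null_vector:
  assumes "finite T" and orbit: "\<And>k. (\<theta> ^^ k) f \<in> span T"
    and lin: "Vector_Spaces.linear scale scale \<theta>"
  obtains r w where "w \<in> span (range (\<lambda>k. (\<theta> ^^ k) f))" and "(\<theta> ^^ r) (f - \<theta> w) = 0"
proof -
  let ?g = "\<lambda>k. (\<theta> ^^ k) f"
  have lin_pow: "Vector_Spaces.linear scale scale (\<theta> ^^ r)" for r
  proof (induction r)
    case 0
    then show ?case using linear_id by (simp add: id_def)
  next
    case (Suc r)
    then show ?case
      using Vector_Spaces.linear_compose[OF Suc lin] by (simp add: comp_def)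
  qed
  obtain r where r: "?g r \<in> span (?g ` {r<..})"
    using iterate_in_span_of_later_iterates[OF assms(1) orbit] by blast
  \<comment> \<open>Each later iterate has a factor \<open>\<theta> ^^ Suc r\<close>, which
    linearity then pulls out of the whole span.\<close>
  have "?g ` {r<..} \<subseteq> (\<theta> ^^ Suc r) ` range ?g"
  proof
    fix z assume "z \<in> ?g ` {r<..}"
    then obtain k where "r < k" "z = ?g k" by auto
    moreover from this have "k = Suc r + (k - Suc r)" by simp
    ultimately have "z = (\<theta> ^^ Suc r) (?g (k - Suc r))"
      by (metis comp_apply funpow_add)
    then show "z \<in> (\<theta> ^^ Suc r) ` range ?g" by blast
  qed
  then have "?g r \<in> span ((\<theta> ^^ Suc r) ` range ?g)"
    using r span_mono by blast
  also have "\<dots> = (\<theta> ^^ Suc r) ` span (range ?g)"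
    using module_hom.span_image[OF lin_pow[unfolded linear_iff_module_hom]] .
  finally obtain w where w: "w \<in> span (range ?g)" "?g r = (\<theta> ^^ Suc r) w"
    by blast
  have "(\<theta> ^^ r) (f - \<theta> w) = ?g r - (\<theta> ^^ r) (\<theta> w)"
    using module_hom.diff[OF lin_pow[unfolded linear_iff_module_hom]] .
  also have "\<dots> = 0"
    using w by (simp add: funpow_swap1)
  finally show thesis
    using that w by blast
qed

end

section \<open>Cartan calculus on Leibniz cochains\<close>

context leibniz_bimodule
begin

sublocale lactM: module_hom scaleM scaleM "lact x" for x
  using linear_lact_module by (simp add: linear_iff_module_hom)

sublocale ractM: module_hom scaleM scaleM "\<lambda>m. ract m x" for x
  using linear_ract_module by (simp add: linear_iff_module_hom)

sublocale lactL: module_hom scaleL scaleM "\<lambda>x. lact x m" for m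
  using linear_lact_algebra by (simp add: linear_iff_module_hom)

sublocale multL: module_hom scaleL scaleL "mult x" for x
  using L.linear_mult_right by (simp add: linear_iff_module_hom)

definition contraction :: "'l \<Rightarrow> ('l list \<Rightarrow> 'm) \<Rightarrow> 'l list \<Rightarrow> 'm" where
  "contraction x f = (\<lambda>ys. f (x # ys))"

text \<open>The degree is read off from the length of the argument list, so one operator serves all
  degrees. Only the left action enters.\<close>

definition lie_derivative :: "'l \<Rightarrow> ('l list \<Rightarrow> 'm) \<Rightarrow> 'l list \<Rightarrow> 'm" where
  "lie_derivative x f =
     (\<lambda>ys. lact x (f ys) - (\<Sum>j<length ys. f (ys[j := mult x (ys ! j)])))"

text \<open>Splitting off the summand for the first slot gives the commutator of Lie derivative and
  contraction. It is the recursion behind the inductions on the list or the degree below.\<close>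

lemma lie_derivative_Cons:
  "lie_derivative x f (y # ys) =
     lie_derivative x (contraction y f) ys - contraction (mult x y) f ys"
  by (simp add: lie_derivative_def contraction_def sum.lessThan_Suc_shift del: sum.lessThan_Suc)

lemma lie_derivative_add: "lie_derivative x (f + g) = lie_derivative x f + lie_derivative x g"
  by (simp add: lie_derivative_def fun_eq_iff lactM.add sum.distrib)

lemma lie_derivative_diff: "lie_derivative x (f - g) = lie_derivative x f - lie_derivative x g"
  by (simp add: lie_derivative_def fun_eq_iff lactM.diff sum_subtractf)

lemma lie_derivative_zero: "lie_derivative x 0 = 0"
  by (simp add: lie_derivative_def fun_eq_iff)

lemma lie_derivative_scale: "lie_derivative x (scaleCL c f) = scaleCL c (lie_derivative x f)"
  by (simp add: lie_derivative_def scaleCL_def fun_eq_iff lactM.scale M.scale_right_diff_distrib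
      M.scale_sum_right)

lemma coboundary_add: "coboundary n (f + g) = coboundary n f + coboundary n g"
  by (simp add: coboundary_def fun_eq_iff lactM.add ractM.add sum.distrib M.scale_right_distrib
      add_ac del: power_Suc)

lemma coboundary_scale: "coboundary n (scaleCL c f) = scaleCL c (coboundary n f)"
  by (simp add: coboundary_def scaleCL_def fun_eq_iff lactM.scale ractM.scale
      M.scale_right_distrib M.scale_sum_right mult.commute[of _ c] del: power_Suc)

lemma coboundary_zero: "coboundary n 0 = 0"
  by (simp add: coboundary_def fun_eq_iff)

lemma coboundary_diff: "coboundary n (f - g) = coboundary n f - coboundary n g"
  using coboundary_add[of n "f - g" g] by (simp add: algebra_simps)

text \<open>Pointwise form of Cartan's formula: the terms of the coboundary in which
  \<open>x\<close> acts or multiplies make up the Lie derivative, and in the others all indices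
  shift by one, which flips the sign. For empty \<open>ys\<close> this fails, as \<open>x\<close> is
  then the last argument and acts from the right.\<close>

lemma coboundary_Cons:
  assumes "0 < length ys"
  shows "coboundary n f (x # ys) =
    (if length ys = n then lie_derivative x f ys - coboundary (n - 1) (contraction x f) ys else 0)"
proof (cases "length ys = n")
  case True
  then obtain m where n: "n = Suc m" "length ys = Suc m"
    using assms by (cases n) auto
  have lie: "lie_derivative x f ys = lact x (f ys) - (\<Sum>j\<le>m. f (ys[j := mult x (ys ! j)]))"
    using n by (simp add: lie_derivative_def lessThan_Suc_atMost del: sum.lessThan_Suc)
  show ?thesis
    unfolding lie using n
    by (simp add: coboundary_def contraction_def omit_def
        sum.lessThan_Suc_shift sum.atMost_Suc_shift sum.distrib sum_negf sum_subtractf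
        del: sum.lessThan_Suc sum.atMost_Suc)
next
  case False
  then show ?thesis
    by (simp add: coboundary_def)
qed

section \<open>Cochain spaces and the operators on them\<close>

lemma scaleCL_apply: "scaleCL c f xs = scaleM c (f xs)"
  by (simp add: scaleCL_def)

sublocale C: vector_space scaleCL
  by unfold_locales
    (simp_all add: scaleCL_def fun_eq_iff M.scale_right_distrib M.scale_left_distrib)

lemma CL_outside: "f \<in> CL n \<Longrightarrow> length xs \<noteq> n \<Longrightarrow> f xs = 0"
  by (simp add: CL_def)

lemma CL_slot: "f \<in> CL n \<Longrightarrow> length xs = n \<Longrightarrow> i < n \<Longrightarrow>
    module_hom scaleL scaleM (\<lambda>x. f (xs[i := x]))"
  by (simp add: CL_def linear_iff_module_hom)

lemma CL_I:
  assumes "\<And>xs. length xs \<noteq> n \<Longrightarrow> f xs = 0"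
    and "\<And>xs i. length xs = n \<Longrightarrow> i < n \<Longrightarrow> module_hom scaleL scaleM (\<lambda>x. f (xs[i := x]))"
  shows "f \<in> CL n"
  using assms by (simp add: CL_def linear_iff_module_hom)

sublocale LM: module_pair scaleL scaleM
  by (simp add: module_pair_def L.module_axioms M.module_axioms)

lemma subspace_CL: "C.subspace (CL n)"
proof (rule C.subspaceI)
  show "0 \<in> CL n"
    by (rule CL_I) (simp_all add: LM.module_hom_zero)
  show "f + g \<in> CL n" if "f \<in> CL n" "g \<in> CL n" for f g
    using that by (intro CL_I) (simp_all add: CL_outside LM.module_hom_add CL_slot)
  show "scaleCL c f \<in> CL n" if "f \<in> CL n" for c f
    using that by (intro CL_I) (simp_all add: scaleCL_def CL_outside LM.module_hom_scale CL_slot)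
qed

lemma CL_head_linear:
  assumes "f \<in> CL (Suc n)" "length ys = n"
  shows "module_hom scaleL scaleM (\<lambda>x. f (x # ys))"
  using CL_slot[OF assms(1), of "0 # ys" 0] assms(2) by simp

lemma contraction_CL:
  assumes "f \<in> CL (Suc n)"
  shows "contraction x f \<in> CL n"
proof (rule CL_I)
  fix xs :: "'l list" and i assume "length xs = n" "i < n"
  then show "module_hom scaleL scaleM (\<lambda>z. contraction x f (xs[i := z]))"
    using CL_slot[OF assms, of "x # xs" "Suc i"] by (simp add: contraction_def)
qed (simp add: contraction_def CL_outside[OF assms])

lemma contraction_add:
  assumes "f \<in> CL (Suc n)"
  shows "contraction (x + y) f = contraction x f + contraction y f"
proof
  fix ys
  show "contraction (x + y) f ys = (contraction x f + contraction y f) ys"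
    using module_hom.add[OF CL_head_linear[OF assms, of ys]] CL_outside[OF assms]
    by (cases "length ys = n") (simp_all add: contraction_def)
qed

lemma lie_derivative_outside:
  assumes "\<And>zs. length zs = length ys \<Longrightarrow> f zs = 0"
  shows "lie_derivative x f ys = 0"
  using assms by (simp add: lie_derivative_def)

lemma lie_derivative_CL:
  assumes "f \<in> CL n"
  shows "lie_derivative x f \<in> CL n"
proof (rule CL_I)
  fix xs :: "'l list" assume "length xs \<noteq> n"
  then show "lie_derivative x f xs = 0"
    by (intro lie_derivative_outside) (simp add: CL_outside[OF assms])
next
  fix xs :: "'l list" and i assume xs: "length xs = n" "i < n"
  \<comment> \<open>For \<open>j = i\<close> the second update overwrites the first, leaving a
    composition with left multiplication; for \<open>j \<noteq> i\<close> the two updates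
    commute.\<close>
  have slot: "module_hom scaleL scaleM (\<lambda>z. f (xs[i := z, j := mult x (xs[i := z] ! j)]))"
    if "j < n" for j
  proof (cases "j = i")
    case True
    then show ?thesis
      using module_hom_compose[OF multL.module_hom_axioms CL_slot[OF assms xs]] xs
      by (simp add: comp_def)
  next
    case False
    then show ?thesis
      using CL_slot[OF assms, of "xs[j := mult x (xs ! j)]" i] xs
      by (simp add: list_update_swap)
  qed
  show "module_hom scaleL scaleM (\<lambda>z. lie_derivative x f (xs[i := z]))"
    unfolding lie_derivative_def
  proof (rule LM.module_hom_sub)
    show "module_hom scaleL scaleM (\<lambda>z. lact x (f (xs[i := z])))"
      using module_hom_compose[OF CL_slot[OF assms xs] lactM.module_hom_axioms]
      by (simp add: comp_def)
    show "module_hom scaleL scaleM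
        (\<lambda>z. \<Sum>j<length (xs[i := z]). f (xs[i := z, j := mult x (xs[i := z] ! j)]))"
      using slot xs by (simp, intro LM.module_hom_sum)
        (simp_all add: L.module_axioms M.module_axioms)
  qed
qed

lemma contraction_lie_derivative:
  "contraction y (lie_derivative x f) =
     lie_derivative x (contraction y f) - contraction (mult x y) f"
  using lie_derivative_Cons by (simp add: contraction_def fun_eq_iff)

lemma cartan_formula:
  assumes "f \<in> CL (Suc n)"
  shows "contraction x (coboundary (Suc n) f) = lie_derivative x f - coboundary n (contraction x f)"
proof
  fix ys
  show "contraction x (coboundary (Suc n) f) ys =
      (lie_derivative x f - coboundary n (contraction x f)) ys"
  proof (cases "length ys = Suc n")
    case True
    then show ?thesis
      using coboundary_Cons[of ys "Suc n" f x] by (simp add: contraction_def)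
  next
    case False
    then have "lie_derivative x f ys = 0"
      by (intro lie_derivative_outside) (simp add: CL_outside[OF assms])
    then show ?thesis
      using False by (simp add: contraction_def coboundary_def)
  qed
qed

text \<open>Induction on the arguments: the empty list is the axiom \<open>LLM\<close>, and in the
  step the terms left over in the first slot cancel by the left Leibniz identity and linearity of
  \<open>f\<close> there.\<close>

lemma lie_derivative_commutator:
  assumes "f \<in> CL (length ys)"
  shows "lie_derivative x (lie_derivative y f) ys - lie_derivative y (lie_derivative x f) ys =
    lie_derivative (mult x y) f ys"
  using assms
proof (induction ys arbitrary: f)
  case Nil
  then show ?case
    by (simp add: lie_derivative_def LLM)
next
  case (Cons z ys)
  then have f: "f \<in> CL (Suc (length ys))" by simp
  have "contraction (mult x (mult y z)) f =
      contraction (mult (mult x y) z) f + contraction (mult y (mult x z)) f"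
    unfolding L.left_leibniz[of x y z] by (rule contraction_add[OF f])
  then have "contraction (mult x (mult y z)) f ys =
      contraction (mult (mult x y) z) f ys + contraction (mult y (mult x z)) f ys"
    by simp
  with Cons.IH[OF contraction_CL[OF f], of z] show ?case
    by (simp add: lie_derivative_Cons contraction_lie_derivative lie_derivative_diff algebra_simps)
qed

text \<open>Degree 0 is the axiom \<open>LML\<close>. In higher degrees both sides are contracted
  with the first argument \<open>y\<close>; after Cartan's formula and the induction hypothesis they
  differ exactly by the commutator identity.\<close>

lemma coboundary_lie_derivative:
  assumes "f \<in> CL n"
  shows "coboundary n (lie_derivative x f) = lie_derivative x (coboundary n f)"
  using assms
proof (induction n arbitrary: f)
  case 0
  show ?case
  proof
    fix ys :: "'l list"
    consider "ys = []" | y where "ys = [y]" | "length ys > 1"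
      by (cases ys; cases "tl ys") auto
    then show "coboundary 0 (lie_derivative x f) ys = lie_derivative x (coboundary 0 f) ys"
    proof cases
      case 2
      then show ?thesis
        by (simp add: coboundary_def lie_derivative_def omit_def LML lactM.neg)
    next
      case 3
      then have "lie_derivative x (coboundary 0 f) ys = 0"
        by (intro lie_derivative_outside) (simp add: coboundary_def)
      with 3 show ?thesis
        by (simp add: coboundary_def)
    qed (simp add: coboundary_def lie_derivative_def)
  qed
next
  case (Suc n)
  show ?case
  proof
    fix ys
    show "coboundary (Suc n) (lie_derivative x f) ys = lie_derivative x (coboundary (Suc n) f) ys"
    proof (cases ys)
      case Nil
      then show ?thesis
        by (simp add: coboundary_def lie_derivative_def)
    next
      case (Cons y zs)
      \<comment> \<open>The commutator lemma covers lists whose length is the degree of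
        \<open>f\<close>; at any other length all three terms vanish.\<close>
      have comm: "lie_derivative x (lie_derivative y f) zs - lie_derivative y (lie_derivative x f) zs =
          lie_derivative (mult x y) f zs"
      proof (cases "length zs = Suc n")
        case True
        then show ?thesis
          using lie_derivative_commutator[of f zs] Suc.prems by simp
      next
        case False
        then show ?thesis
          using Suc.prems by (simp add: CL_outside[of _ "Suc n"] lie_derivative_CL)
      qed
      have left: "contraction y (coboundary (Suc n) (lie_derivative x f)) =
          lie_derivative y (lie_derivative x f) - lie_derivative x (coboundary n (contraction y f))
          + coboundary n (contraction (mult x y) f)"
        using Suc by (simp add: cartan_formula lie_derivative_CL contraction_lie_derivative
            coboundary_diff contraction_CL)
      have right: "contraction y (lie_derivative x (coboundary (Suc n) f)) =
          lie_derivative x (lie_derivative y f) - lie_derivative x (coboundary n (contraction y f))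
          - (lie_derivative (mult x y) f - coboundary n (contraction (mult x y) f))"
        using Suc by (simp add: cartan_formula contraction_lie_derivative lie_derivative_diff)
      have "contraction y (coboundary (Suc n) (lie_derivative x f)) zs =
          contraction y (lie_derivative x (coboundary (Suc n) f)) zs"
        unfolding left right using comm by (simp add: algebra_simps)
      then show ?thesis
        using Cons by (simp add: contraction_def)
    qed
  qed
qed

section \<open>Lie derivatives of cocycles and their injectivity modulo a subspace\<close>

lemma subspace_cocycles: "C.subspace (cocycles n)"
proof (rule C.subspaceI)
  note CL = subspace_CL[of n]
  show "0 \<in> cocycles n"
    using C.subspace_0[OF CL] by (simp add: cocycles_def coboundary_zero)
  show "f + g \<in> cocycles n" if "f \<in> cocycles n" "g \<in> cocycles n" for f g
    using that C.subspace_add[OF CL] by (simp add: cocycles_def coboundary_add)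
  show "scaleCL c f \<in> cocycles n" if "f \<in> cocycles n" for c f
    using that C.subspace_scale[OF CL] by (simp add: cocycles_def coboundary_scale)
qed

lemma lie_derivative_cocycles:
  "f \<in> cocycles n \<Longrightarrow> lie_derivative x f \<in> cocycles n"
  by (simp add: cocycles_def lie_derivative_CL coboundary_lie_derivative lie_derivative_zero)

lemma lie_derivative_cocycle_coboundary:
  assumes "f \<in> cocycles (Suc n)"
  shows "lie_derivative x f = coboundary n (contraction x f)"
proof -
  have "contraction x (0 :: 'l list \<Rightarrow> 'm) = 0"
    by (simp add: contraction_def fun_eq_iff)
  then show ?thesis
    using assms cartan_formula[of f n x] by (simp add: cocycles_def)
qed

lemma lie_derivative_injective_modulo:
  assumes V: "M.subspace V"
    and inj: "\<And>u. u \<in> U \<Longrightarrow> lact x u \<in> V \<Longrightarrow> u \<in> V"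
    and nil: "\<And>y. \<exists>k. (mult x ^^ k) y = 0"
    and h: "h \<in> CL n" "\<And>ys. h ys \<in> U" "\<And>ys. lie_derivative x h ys \<in> V"
  shows "h ys \<in> V"
proof -
  \<comment> \<open>Modulo \<open>V\<close>, \<open>x \<cdot> h ys\<close> is a sum of values of \<open>h\<close> at lists of smaller total depth.\<close>
  define depth where "depth y = (LEAST k. (mult x ^^ k) y = 0)" for y
  have depth: "(mult x ^^ depth y) y = 0" for y
    unfolding depth_def using LeastI_ex[OF nil] .
  have depth_mult: "depth (mult x y) < depth y" if "y \<noteq> 0" for y
  proof (cases "depth y")
    case 0
    then show ?thesis using depth[of y] that by simp
  next
    case (Suc k)
    then have "(mult x ^^ k) (mult x y) = 0"
      using depth[of y] by (simp add: funpow_swap1)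
    then have "depth (mult x y) \<le> k"
      unfolding depth_def by (rule Least_le)
    then show ?thesis using Suc by simp
  qed
  show ?thesis
  proof (induction "sum_list (map depth ys)" arbitrary: ys rule: less_induct)
    case less
    show ?case
    proof (cases "length ys = n")
      case False
      then show ?thesis
        using CL_outside[OF h(1)] M.subspace_0[OF V] by simp
    next
      case len: True
      show ?thesis
      \<comment> \<open>Multiplying an entry 0 by \<open>x\<close> does not lower its depth, so this
        case is settled by multilinearity instead.\<close>
      proof (cases "0 \<in> set ys")
        case True
        then obtain i where "i < n" "ys ! i = 0"
          using len by (metis in_set_conv_nth)
        then have "h ys = 0"
          using module_hom.zero[OF CL_slot[OF h(1) len]] by (metis list_update_id)
        then show ?thesis
          using M.subspace_0[OF V] by simp
      next
        case False
        have "h (ys[j := mult x (ys ! j)]) \<in> V" if j: "j < length ys" for j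
        proof (rule less)
          have "ys ! j \<noteq> 0"
            using False j nth_mem by fastforce
          then have "depth (mult x (ys ! j)) < map depth ys ! j"
            using depth_mult j by simp
          moreover have "map depth ys ! j \<le> sum_list (map depth ys)"
            using j by (intro elem_le_sum_list) simp
          ultimately show "sum_list (map depth (ys[j := mult x (ys ! j)])) < sum_list (map depth ys)"
            using j by (simp add: map_update sum_list_update)
        qed
        then have "(\<Sum>j<length ys. h (ys[j := mult x (ys ! j)])) \<in> V"
          by (intro M.subspace_sum[OF V]) simp
        then have "lact x (h ys) \<in> V"
          using M.subspace_add[OF V h(3)[of ys]] by (fastforce simp: lie_derivative_def)
        then show ?thesis
          using inj h(2) by blast
      qed
    qed
  qed
qed

text \<open>Expanding the first argument in the basis \<open>BL\<close> writes \<open>f\<close> as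
  the sum of the dual basis vectors tensored with the contractions \<open>contraction b f\<close>,
  which have degree one less. The set \<open>T\<close> supplies the dimension bound for Fitting's
  lemma.\<close>

lemma CL_finite_span:
  assumes BL: "finite BL" "L.independent BL" "L.span BL = UNIV"
    and BM: "finite BM" "M.span BM = UNIV"
  shows "\<exists>T. finite T \<and> CL n \<subseteq> C.span T"
proof (induction n)
  case 0
  define \<delta> :: "'m \<Rightarrow> 'l list \<Rightarrow> 'm" where "\<delta> m = (\<lambda>xs. if xs = [] then m else 0)" for m
  interpret \<delta>: module_hom scaleM scaleCL \<delta>
    by unfold_locales (auto simp: \<delta>_def scaleCL_def fun_eq_iff)
  have "f \<in> C.span (\<delta> ` BM)" if "f \<in> CL 0" for f
  proof -
    have "f = \<delta> (f [])"
      using CL_outside[OF that] by (auto simp: \<delta>_def)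
    then show ?thesis
      using \<delta>.span_image[of BM] BM(2) by blast
  qed
  then show ?case
    using BM(1) by (intro exI[of _ "\<delta> ` BM"]) auto
next
  case (Suc n)
  then obtain T where T: "finite T" "CL n \<subseteq> C.span T" by blast
  \<comment> \<open>\<open>ext b g\<close> is the tensor product of the coordinate functional of
    \<open>b\<close> with \<open>g\<close>.\<close>
  define ext :: "'l \<Rightarrow> ('l list \<Rightarrow> 'm) \<Rightarrow> 'l list \<Rightarrow> 'm" where
    "ext b g = (\<lambda>xs. case xs of [] \<Rightarrow> 0 | x # ys \<Rightarrow> scaleM (L.representation BL x b) (g ys))" for b g
  have ext: "module_hom scaleCL scaleCL (ext b)" for b
    by unfold_locales
      (auto simp: ext_def scaleCL_def fun_eq_iff M.scale_right_distrib mult.commute split: list.splits)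
  have sum_apply: "(\<Sum>b\<in>B. F b) xs = (\<Sum>b\<in>B. F b xs)"
    for B :: "'l set" and F :: "'l \<Rightarrow> 'l list \<Rightarrow> 'm" and xs
    by (induction B rule: infinite_finite_induct) simp_all
  have "f \<in> C.span (\<Union>b\<in>BL. ext b ` T)" if f: "f \<in> CL (Suc n)" for f
  proof -
    have "f = (\<Sum>b\<in>BL. ext b (contraction b f))"
    proof
      fix xs
      show "f xs = (\<Sum>b\<in>BL. ext b (contraction b f)) xs"
      proof (cases "length xs = Suc n")
        case True
        then obtain x ys where xs: "xs = x # ys" "length ys = n"
          by (cases xs) auto
        interpret hd: module_hom scaleL scaleM "\<lambda>z. f (z # ys)"
          using CL_head_linear[OF f xs(2)] .
        have "x = (\<Sum>b\<in>BL. scaleL (L.representation BL x b) b)"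
          using L.sum_representation_eq[OF BL(2) _ BL(1) order_refl, of x] BL(3) by simp
        then have "f (x # ys) = f ((\<Sum>b\<in>BL. scaleL (L.representation BL x b) b) # ys)"
          by simp
        also have "\<dots> = (\<Sum>b\<in>BL. scaleM (L.representation BL x b) (f (b # ys)))"
          by (simp add: hd.sum hd.scale)
        finally show ?thesis
          by (simp add: sum_apply ext_def contraction_def xs)
      next
        case False
        then show ?thesis
          using CL_outside[OF f] by (cases xs) (simp_all add: sum_apply ext_def contraction_def)
      qed
    qed
    also have "\<dots> \<in> C.span (\<Union>b\<in>BL. ext b ` T)"
    proof (rule C.span_sum)
      fix b assume b: "b \<in> BL"
      have "ext b (contraction b f) \<in> ext b ` C.span T"
        using contraction_CL[OF f] T(2) by blast
      also have "\<dots> = C.span (ext b ` T)"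
        using module_hom.span_image[OF ext] by simp
      also have "\<dots> \<subseteq> C.span (\<Union>b\<in>BL. ext b ` T)"
        using b by (intro C.span_mono) blast
      finally show "ext b (contraction b f) \<in> C.span (\<Union>b\<in>BL. ext b ` T)" .
    qed
    finally show ?thesis .
  qed
  then show ?case
    using BL(1) T(1) by (intro exI[of _ "\<Union>b\<in>BL. ext b ` T"]) auto
qed

text \<open>Fitting's lemma inside the invariant space \<open>Z\<close> of cocycles with values in
  \<open>U\<close> yields \<open>w\<close> such that some power of the Lie derivative kills
  \<open>f - lie_derivative x w\<close>. Injectivity modulo \<open>V\<close> then removes the
  factors of that power one at a time.\<close>

lemma cocycle_push_down:
  assumes T: "finite T" "CL n \<subseteq> C.span T"
    and U: "M.subspace U" "\<And>u. u \<in> U \<Longrightarrow> lact x u \<in> U"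
    and V: "M.subspace V" "\<And>u. u \<in> U \<Longrightarrow> lact x u \<in> V \<Longrightarrow> u \<in> V"
    and nil: "\<And>y. \<exists>k. (mult x ^^ k) y = 0"
    and f: "f \<in> cocycles n" "\<And>ys. f ys \<in> U"
  obtains w where "w \<in> cocycles n" "\<And>ys. (f - lie_derivative x w) ys \<in> V"
proof -
  let ?\<theta> = "lie_derivative x"
  define Z where "Z = {g \<in> cocycles n. \<forall>ys. g ys \<in> U}"
  have Z: "C.subspace Z"
  proof (rule C.subspaceI)
    note cocycles = subspace_cocycles[of n]
    show "0 \<in> Z"
      using C.subspace_0[OF cocycles] M.subspace_0[OF U(1)] by (simp add: Z_def)
    show "g + h \<in> Z" if "g \<in> Z" "h \<in> Z" for g h
      using that C.subspace_add[OF cocycles] M.subspace_add[OF U(1)] by (simp add: Z_def)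
    show "scaleCL c g \<in> Z" if "g \<in> Z" for c g
      using that C.subspace_scale[OF cocycles] M.subspace_scale[OF U(1)]
      by (simp add: Z_def scaleCL_apply)
  qed
  have \<theta>Z: "?\<theta> g \<in> Z" if "g \<in> Z" for g
  proof -
    have "?\<theta> g ys \<in> U" for ys
      unfolding lie_derivative_def using that U
      by (intro M.subspace_diff M.subspace_sum) (auto simp: Z_def)
    then show ?thesis
      using that lie_derivative_cocycles by (simp add: Z_def)
  qed
  have orbit: "(?\<theta> ^^ k) f \<in> Z" for k
    by (induction k) (use f \<theta>Z in \<open>auto simp: Z_def\<close>)
  have Z_CL: "Z \<subseteq> CL n"
    by (auto simp: Z_def cocycles_def)
  have lin: "Vector_Spaces.linear scaleCL scaleCL ?\<theta>"
    using C.vector_space_axioms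
    by (simp add: Vector_Spaces.linear_iff lie_derivative_add lie_derivative_scale)
  have "(?\<theta> ^^ k) f \<in> C.span T" for k
    using orbit Z_CL T(2) by blast
  then obtain r w where w: "w \<in> C.span (range (\<lambda>k. (?\<theta> ^^ k) f))" "(?\<theta> ^^ r) (f - ?\<theta> w) = 0"
    using C.fitting_null_vector[OF T(1) _ lin] by blast
  have "w \<in> Z"
    using w(1) C.span_minimal[OF _ Z, of "range (\<lambda>k. (?\<theta> ^^ k) f)"] orbit by blast
  then have "f - ?\<theta> w \<in> Z"
    using C.subspace_diff[OF Z] \<theta>Z orbit[of 0] by simp
  have "h ys \<in> V" if "h \<in> Z" "\<And>ys. (?\<theta> ^^ r) h ys \<in> V" for h r ys
    using that
  proof (induction r arbitrary: h ys)
    case (Suc r)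
    have "?\<theta> h ys \<in> V" for ys
      using Suc.IH[OF \<theta>Z[OF Suc.prems(1)]] Suc.prems(2) by (simp add: funpow_swap1)
    then show ?case
      using lie_derivative_injective_modulo[OF V nil, where h = h] Suc.prems(1) Z_CL by (auto simp: Z_def)
  qed simp
  from this[OF \<open>f - ?\<theta> w \<in> Z\<close>, of r] have "(f - ?\<theta> w) ys \<in> V" for ys
    using w(2) M.subspace_0[OF V(1)] by simp
  then show thesis
    using that \<open>w \<in> Z\<close> by (auto simp: Z_def)
qed

section \<open>Composition series of bimodules\<close>

abbreviation subbimodule :: "'m set \<Rightarrow> bool" where
  "subbimodule U \<equiv> is_subbimodule U self_bimodule"

lemma subbimodule_iff:
  "subbimodule U \<longleftrightarrow> M.subspace U \<and> (\<forall>x. \<forall>u\<in>U. lact x u \<in> U \<and> ract u x \<in> U)"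
  unfolding is_subbimodule_def self_bimodule_def M.subspace_def by auto

lemma subbimodule_subspace: "subbimodule U \<Longrightarrow> M.subspace U"
  by (simp add: subbimodule_iff)

lemma coset_eq:
  assumes "subbimodule V"
  shows "a +o V = b +o V \<longleftrightarrow> a - b \<in> V"
  using subbimodule_subspace[OF assms]
  by (intro coset_eq_iff) (auto intro: M.subspace_0 M.subspace_add M.subspace_neg)

lemma coset_eq_zero: "subbimodule V \<Longrightarrow> a +o V = V \<longleftrightarrow> a \<in> V"
  using coset_eq[of V a 0] by simp

lemma coset_action:
  assumes V: "subbimodule V" and \<phi>: "module_hom scaleM scaleM \<phi>" "\<phi> ` V \<subseteq> V"
  shows "\<phi> ` (a +o V) + V = \<phi> a +o V"
  using M.subspace_0[OF subbimodule_subspace[OF V]] M.subspace_add[OF subbimodule_subspace[OF V]]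
  by (intro coset_image[OF _ \<phi>(2)]) (simp_all add: additive_def module_hom.add[OF \<phi>(1)])

lemma coset_operations:
  assumes V: "subbimodule V"
  shows "vs_add (quotient_bimodule U V) (a +o V) (b +o V) = (a + b) +o V"
    and "vs_scale (quotient_bimodule U V) c (a +o V) = scaleM c a +o V"
    and "bm_left (quotient_bimodule U V) x (a +o V) = lact x a +o V"
    and "bm_right (quotient_bimodule U V) (a +o V) x = ract a x +o V"
proof -
  note sub = subbimodule_subspace[OF V]
  have "V + V = V"
    using M.subspace_0[OF sub] M.subspace_add[OF sub]
    by (force simp: set_plus_def)
  then show "vs_add (quotient_bimodule U V) (a +o V) (b +o V) = (a + b) +o V"
    by (simp add: quotient_bimodule_def set_plus_rearrange)
  have "module_hom scaleM scaleM (scaleM c)"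
    using M.module_hom_scale_self by (simp add: linear_iff_module_hom)
  then show "vs_scale (quotient_bimodule U V) c (a +o V) = scaleM c a +o V"
    using M.subspace_scale[OF sub]
    by (simp add: quotient_bimodule_def) (intro coset_action[OF V]; auto)
  show "bm_left (quotient_bimodule U V) x (a +o V) = lact x a +o V"
    using V by (simp add: quotient_bimodule_def)
      (intro coset_action[OF V lactM.module_hom_axioms]; auto simp: subbimodule_iff)
  show "bm_right (quotient_bimodule U V) (a +o V) x = ract a x +o V"
    using V by (simp add: quotient_bimodule_def)
      (intro coset_action[OF V ractM.module_hom_axioms]; auto simp: subbimodule_iff)
qed

lemma quotient_carrier:
  "vs_carrier (quotient_bimodule U V) = (\<lambda>u. u +o V) ` U" "vs_zero (quotient_bimodule U V) = V"
  by (simp_all add: quotient_bimodule_def)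

lemma subbimodule_image:
  assumes "subbimodule V" "subbimodule A" "A \<subseteq> U"
  shows "is_subbimodule ((\<lambda>a. a +o V) ` A) (quotient_bimodule U V)"
proof -
  note A = assms(2)[unfolded subbimodule_iff]
  have "V = 0 +o V" "0 \<in> A"
    using A M.subspace_0 by simp_all
  then have "V \<in> (\<lambda>a. a +o V) ` A" by blast
  then show ?thesis
    using A assms(3) unfolding is_subbimodule_def quotient_carrier
    by (auto simp: coset_operations[OF assms(1)] intro!: imageI
        intro: M.subspace_add M.subspace_scale)
qed

text \<open>Surjective half of the correspondence between subbimodules of a quotient and
  intermediate subbimodules.\<close>

lemma subbimodule_preimage:
  assumes U: "subbimodule U" and V: "subbimodule V" "V \<subseteq> U"
    and S: "is_subbimodule S (quotient_bimodule U V)"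
  obtains A where "subbimodule A" "V \<subseteq> A" "A \<subseteq> U" "S = (\<lambda>a. a +o V) ` A"
proof -
  \<comment> \<open>The preimage is taken in the whole module; it lies in \<open>U\<close> because
    \<open>S\<close> consists of cosets of elements of \<open>U\<close> and
    \<open>V \<subseteq> U\<close>.\<close>
  define A where "A = {u. u +o V \<in> S}"
  have carrier: "S \<subseteq> (\<lambda>u. u +o V) ` U" and zero: "V \<in> S"
    and add: "\<And>a b. a +o V \<in> S \<Longrightarrow> b +o V \<in> S \<Longrightarrow> (a + b) +o V \<in> S"
    and scale: "\<And>c a. a +o V \<in> S \<Longrightarrow> scaleM c a +o V \<in> S"
    and acts: "\<And>x a. a +o V \<in> S \<Longrightarrow> lact x a +o V \<in> S \<and> ract a x +o V \<in> S"
    using S unfolding is_subbimodule_def quotient_carrier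
    by (metis coset_operations[OF V(1)])+
  have "subbimodule A"
    unfolding subbimodule_iff A_def
    using zero add scale acts by (auto intro!: M.subspaceI)
  moreover have "V \<subseteq> A"
    using zero by (auto simp: A_def coset_eq_zero[OF V(1), THEN iffD2])
  moreover have "A \<subseteq> U"
  proof
    fix a assume "a \<in> A"
    then obtain u where "u \<in> U" "a - u \<in> V"
      using carrier coset_eq[OF V(1)] by (auto simp: A_def)
    then show "a \<in> U"
      using M.subspace_add[OF subbimodule_subspace[OF U], of "a - u" u] V(2) by auto
  qed
  moreover have "S = (\<lambda>a. a +o V) ` A"
    using carrier by (auto simp: A_def)
  ultimately show thesis using that by blast
qed

text \<open>By the correspondence of subbimodules, simplicity becomes maximality of \<open>V\<close>
  in \<open>U\<close>, so the later arguments can work in the module itself, without cosets.\<close>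

lemma simple_quotient_iff:
  assumes U: "subbimodule U" and V: "subbimodule V" "V \<subseteq> U"
  shows "simple_bimodule (quotient_bimodule U V) \<longleftrightarrow>
    U \<noteq> V \<and> (\<forall>A. subbimodule A \<and> V \<subseteq> A \<and> A \<subseteq> U \<longrightarrow> A = V \<or> A = U)"
proof -
  let ?\<pi> = "\<lambda>a. a +o V"
  have zero: "?\<pi> ` A = {V} \<longleftrightarrow> A = V" if "subbimodule A" "V \<subseteq> A" for A
  proof -
    have "A \<noteq> {}"
      using that M.subspace_0 subbimodule_subspace by blast
    then have "?\<pi> ` A = {V} \<longleftrightarrow> (\<forall>a\<in>A. ?\<pi> a = V)"
      by (auto simp: image_iff)
    also have "\<dots> \<longleftrightarrow> A \<subseteq> V"
      by (auto simp: coset_eq_zero[OF V(1)])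
    finally show ?thesis
      using that(2) by auto
  qed
  have full: "?\<pi> ` A = ?\<pi> ` U \<longleftrightarrow> A = U" if A: "subbimodule A" "V \<subseteq> A" "A \<subseteq> U" for A
  proof
    assume eq: "?\<pi> ` A = ?\<pi> ` U"
    have "u \<in> A" if "u \<in> U" for u
    proof -
      have "?\<pi> u \<in> ?\<pi> ` A"
        using that by (simp add: eq)
      then obtain a where "a \<in> A" "?\<pi> u = ?\<pi> a" by (rule imageE)
      then have "a \<in> A" "u - a \<in> V"
        using coset_eq[OF V(1)] by simp_all
      then show "u \<in> A"
        using M.subspace_add[OF subbimodule_subspace[OF A(1)], of "u - a" a] A(2) by auto
    qed
    then show "A = U" using A by blast
  qed simp
  show ?thesis
    unfolding simple_bimodule_def vspace_is_zero_def quotient_carrier zero[OF U V(2)]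
  proof (intro conj_cong refl iffI allI impI)
    fix A assume "\<forall>S. is_subbimodule S (quotient_bimodule U V) \<longrightarrow> S = {V} \<or> S = ?\<pi> ` U"
      and A: "subbimodule A \<and> V \<subseteq> A \<and> A \<subseteq> U"
    moreover from this have "is_subbimodule (?\<pi> ` A) (quotient_bimodule U V)"
      using subbimodule_image[OF V(1)] by simp
    ultimately have "?\<pi> ` A = {V} \<or> ?\<pi> ` A = ?\<pi> ` U" by blast
    then show "A = V \<or> A = U"
      using zero[of A] full[of A] A by blast
  next
    fix S assume "\<forall>A. subbimodule A \<and> V \<subseteq> A \<and> A \<subseteq> U \<longrightarrow> A = V \<or> A = U"
      and "is_subbimodule S (quotient_bimodule U V)"
    moreover from subbimodule_preimage[OF U V this(2)] obtain A
      where "subbimodule A" "V \<subseteq> A" "A \<subseteq> U" "S = ?\<pi> ` A" .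
    ultimately show "S = {V} \<or> S = ?\<pi> ` U"
      using zero[of A] by blast
  qed
qed

text \<open>The hypothesis on composition factors yields something only once a series exists.
  Induction on the dimension: below \<open>U\<close> comes a proper subbimodule of largest
  dimension, which is maximal.\<close>

lemma composition_series_of_subbimodule:
  assumes fd: "finite_dimensional_vector_space scaleM B" and "subbimodule U"
  shows "\<exists>Us. Us \<noteq> [] \<and> hd Us = {0} \<and> last Us = U \<and> (\<forall>W\<in>set Us. subbimodule W) \<and>
    (\<forall>i. Suc i < length Us \<longrightarrow>
       Us ! i \<subseteq> Us ! Suc i \<and> simple_bimodule (quotient_bimodule (Us ! Suc i) (Us ! i)))"
  using assms(2)
proof (induction "M.dim U" arbitrary: U rule: less_induct)
  case less
  interpret F: finite_dimensional_vector_space scaleM B by (fact fd)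
  show ?case
  proof (cases "U = {0}")
    case True
    then show ?thesis
      using less.prems by (intro exI[of _ "[U]"]) simp
  next
    case False
    have dim_less: "M.dim W < M.dim U" if "subbimodule W" "W \<subset> U" for W
    proof (rule F.dim_psubset)
      have "M.span W = W" "M.span U = U"
        using that(1) less.prems by (simp_all add: subbimodule_subspace)
      then show "M.span W \<subset> M.span U" using that(2) by (simp only:)
    qed
    have "subbimodule {0}"
      by (simp add: subbimodule_iff)
    moreover have "{0} \<subset> U"
      using False M.subspace_0[OF subbimodule_subspace[OF less.prems]] by blast
    ultimately obtain V where V: "subbimodule V" "V \<subset> U"
      and max: "\<And>W. subbimodule W \<Longrightarrow> W \<subset> U \<Longrightarrow> M.dim W \<le> M.dim V"
      using ex_has_greatest_nat[of "\<lambda>W. subbimodule W \<and> W \<subset> U" "{0}" M.dim "M.dim U"] dim_less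
      by blast
    have "A = V \<or> A = U" if "subbimodule A" "V \<subseteq> A" "A \<subseteq> U" for A
    proof (rule disjCI)
      assume "A \<noteq> U"
      then have "M.dim A \<le> M.dim V" using max that by blast
      then show "A = V"
        using F.subspace_dim_equal[of V A] V(1) that subbimodule_subspace by blast
    qed
    then have simple: "simple_bimodule (quotient_bimodule U V)"
      using simple_quotient_iff[OF less.prems V(1)] V(2) by blast
    obtain Us where Us: "Us \<noteq> []" "hd Us = {0}" "last Us = V" "\<forall>W\<in>set Us. subbimodule W"
      "\<forall>i. Suc i < length Us \<longrightarrow>
         Us ! i \<subseteq> Us ! Suc i \<and> simple_bimodule (quotient_bimodule (Us ! Suc i) (Us ! i))"
      using less.hyps[OF dim_less[OF V] V(1)] by blast
    have "(Us @ [U]) ! i \<subseteq> (Us @ [U]) ! Suc i \<and>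
        simple_bimodule (quotient_bimodule ((Us @ [U]) ! Suc i) ((Us @ [U]) ! i))"
      if "Suc i < length (Us @ [U])" for i
    proof (cases "Suc i < length Us")
      case True
      then show ?thesis using Us(5) by (simp add: nth_append)
    next
      case False
      then have "length Us = Suc i" using that by simp
      then have "(Us @ [U]) ! i = V" "(Us @ [U]) ! Suc i = U"
        using Us(1,3) by (simp_all add: nth_append last_conv_nth)
      then show ?thesis using simple V(2) by simp
    qed
    then show ?thesis
      using Us less.prems by (intro exI[of _ "Us @ [U]"]) auto
  qed
qed

section \<open>Elements acting injectively on a simple subquotient\<close>

lemma left_multiplication_nilpotent:
  assumes "L.nilpotent"
  shows "\<exists>k. (mult x ^^ k) y = 0"
proof -
  have "L.is_product (Suc k) ((mult x ^^ k) y)" for k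
  proof (induction k)
    case 0
    then show ?case using L.single by simp
  next
    case (Suc k)
    then show ?case using L.product[OF L.single] by fastforce
  qed
  then show ?thesis
    using assms unfolding L.nilpotent_def by (metis Suc_pred)
qed

lemma nontrivial_simple_has_injective_action:
  assumes nilpotent: "L.nilpotent"
    and U: "subbimodule U" and V: "subbimodule V" "V \<subseteq> U"
    and simple: "simple_bimodule (quotient_bimodule U V)"
    and nontrivial: "\<not> trivial_bimodule (quotient_bimodule U V)"
  obtains x where "\<And>u. u \<in> U \<Longrightarrow> lact x u \<in> V \<Longrightarrow> u \<in> V"
proof -
  note subV = subbimodule_subspace[OF V(1)] and subU = subbimodule_subspace[OF U]
  have actV: "lact y v \<in> V" "ract v y \<in> V" if "v \<in> V" for v y
    using V that by (auto simp: subbimodule_iff)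
  have actU: "lact y u \<in> U" "ract u y \<in> U" if "u \<in> U" for u y
    using U that by (auto simp: subbimodule_iff)
  have simpleD: "A = V \<or> A = U" if "subbimodule A" "V \<subseteq> A" "A \<subseteq> U" for A
    using simple simple_quotient_iff[OF U V] that by blast
  \<comment> \<open>Modulo \<open>V\<close> this is the annihilator of the right action. It contains
    all \<open>lact y u + ract u y\<close>, so by simplicity \<open>U / V\<close> is symmetric
    (\<open>K = V\<close>) or has zero right action (\<open>K = U\<close>).\<close>
  define K where "K = {u \<in> U. \<forall>y. ract u y \<in> V}"
  have K_Int: "K = U \<inter> (\<Inter>y\<in>UNIV. {u. ract u y \<in> V})"
    by (auto simp: K_def)
  have "M.subspace K"
    unfolding K_Int
    by (intro M.subspace_inter[OF subU] M.subspace_Int ractM.subspace_linear_preimage[OF subV])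
  moreover have "lact x u \<in> K" "ract u x \<in> K" if "u \<in> K" for u x
    using that actU actV M.subspace_diff[OF subV] by (simp_all add: K_def LML MLL)
  ultimately have "subbimodule K"
    by (simp add: subbimodule_iff)
  then have "K = V \<or> K = U"
    by (rule simpleD) (use V(2) actV in \<open>auto simp: K_def\<close>)
  then have sym_or_anti: "(\<forall>u\<in>U. \<forall>y. lact y u + ract u y \<in> V) \<or> (\<forall>u\<in>U. \<forall>y. ract u y \<in> V)"
  proof
    assume "K = V"
    have "lact y u + ract u y \<in> K" if "u \<in> U" for u y
      using that actU M.subspace_add[OF subU] M.subspace_0[OF subV]
      by (simp add: K_def ractM.add LML MLL)
    then show ?thesis using \<open>K = V\<close> by blast
  qed (auto simp: K_def)
  \<comment> \<open>In both cases the right action vanishes wherever the left one does, so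
    non-triviality must show in the left action.\<close>
  have ract_in: "ract u y \<in> V" if "u \<in> U" "lact y u \<in> V" for u y
    using sym_or_anti
  proof
    assume "\<forall>u\<in>U. \<forall>y. lact y u + ract u y \<in> V"
    then show ?thesis
      using that M.subspace_diff[OF subV, of "lact y u + ract u y" "lact y u"] by simp
  qed (use that in blast)
  have "\<exists>x. \<exists>u\<in>U. lact x u \<notin> V"
  proof (rule ccontr)
    assume "\<not> ?thesis"
    then have "lact x u \<in> V" "ract u x \<in> V" if "u \<in> U" for u x
      using that ract_in by auto
    then have "trivial_bimodule (quotient_bimodule U V)"
      unfolding trivial_bimodule_def quotient_carrier
      by (auto simp: coset_operations[OF V(1)] coset_eq_zero[OF V(1)])
    then show False using nontrivial by contradiction
  qed
  then obtain x0 where x0: "\<exists>u\<in>U. lact x0 u \<notin> V" by blast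
  \<comment> \<open>If every \<open>x\<close> acting non-trivially had a \<open>mult y x\<close>
    acting non-trivially, there would be such products of any length, against nilpotency.\<close>
  have "\<exists>x. (\<exists>u\<in>U. lact x u \<notin> V) \<and> (\<forall>y. \<forall>u\<in>U. lact (mult y x) u \<in> V)"
  proof (rule ccontr)
    assume no_central: "\<not> ?thesis"
    have "\<exists>x. L.is_product (Suc k) x \<and> (\<exists>u\<in>U. lact x u \<notin> V)" for k
    proof (induction k)
      case 0
      then show ?case using x0 L.single by auto
    next
      case (Suc k)
      then obtain x where x: "L.is_product (Suc k) x" "\<exists>u\<in>U. lact x u \<notin> V" by blast
      then obtain y where "\<exists>u\<in>U. lact (mult y x) u \<notin> V" using no_central by blast
      moreover have "L.is_product (Suc (Suc k)) (mult y x)"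
        using L.product[OF L.single x(1)] by simp
      ultimately show ?case by blast
    qed
    moreover obtain k where "\<And>z. L.is_product (Suc k) z \<Longrightarrow> z = 0"
      using nilpotent unfolding L.nilpotent_def by (metis Suc_pred)
    ultimately show False
      using M.subspace_0[OF subV] lactL.zero by metis
  qed
  then obtain x where x: "\<exists>u\<in>U. lact x u \<notin> V" and central: "\<And>y u. u \<in> U \<Longrightarrow> lact (mult y x) u \<in> V"
    by blast
  \<comment> \<open>Schur's argument: by \<open>LLM\<close> and the choice of \<open>x\<close>, its
    left action commutes modulo \<open>V\<close> with all left actions, so its kernel is a
    subbimodule. It is not \<open>U\<close>, hence it is \<open>V\<close>.\<close>
  define A where "A = {u \<in> U. lact x u \<in> V}"
  have left: "lact x (lact y u) \<in> V" if "u \<in> A" for u y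
  proof -
    have "lact x (lact y u) = lact y (lact x u) - lact (mult y x) u"
      by (simp add: LLM)
    then show ?thesis
      using that central actV M.subspace_diff[OF subV] by (simp add: A_def)
  qed
  have right: "lact x (ract u y) \<in> V" if u: "u \<in> A" for u y
    using sym_or_anti
  proof
    assume "\<forall>u\<in>U. \<forall>y. lact y u + ract u y \<in> V"
    then have "lact x (lact y u + ract u y) \<in> V"
      using u actV by (simp add: A_def)
    then show ?thesis
      using M.subspace_diff[OF subV _ left[OF u, of y]] by (fastforce simp: lactM.add)
  qed (use u actV in \<open>simp add: A_def\<close>)
  have "A = U \<inter> {u. lact x u \<in> V}"
    by (auto simp: A_def)
  then have "M.subspace A"
    using M.subspace_inter[OF subU lactM.subspace_linear_preimage[OF subV]] by simp
  then have "subbimodule A"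
    using left right actU by (auto simp: subbimodule_iff A_def)
  then have "A = V \<or> A = U"
    by (rule simpleD) (use V(2) actV in \<open>auto simp: A_def\<close>)
  moreover have "A \<noteq> U"
    using x by (auto simp: A_def)
  ultimately have "A = V" by blast
  then show thesis
    using that by (auto simp: A_def)
qed

section \<open>Vanishing of cohomology\<close>

text \<open>On a generator, the right-hand sides of \<open>LML\<close> and \<open>MLL\<close>
  cancel. Thus the elements of the kernel give cocycles of degree 0.\<close>

lemma ract_antisymmetric_kernel:
  assumes "m \<in> antisymmetric_kernel"
  shows "ract m y = 0"
  using assms unfolding antisymmetric_kernel_def
proof (induction rule: M.span_induct)
  case base
  show ?case by (rule ractM.subspace_kernel)
next
  case (step m)
  then show ?case by (auto simp: ractM.add LML MLL)
qed

lemma coboundary_0_eq_zero_iff: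
  "coboundary 0 f = 0 \<longleftrightarrow> (\<forall>x. ract (f []) x = 0)"
proof
  assume eq: "coboundary 0 f = 0"
  have "coboundary 0 f [x] = 0" for x
    by (simp add: eq)
  then show "\<forall>x. ract (f []) x = 0"
    by (simp add: coboundary_def omit_def)
next
  assume "\<forall>x. ract (f []) x = 0"
  then show "coboundary 0 f = 0"
    by (auto simp: coboundary_def omit_def fun_eq_iff length_Suc_conv)
qed

text \<open>
  The image of \<open>d\<^sup>-\<^sup>1\<close> is zero, so in degree \<open>0\<close> the subspace that absorbs all Lie derivatives of
  cocycles is the anti-symmetric kernel.
\<close>

definition expected_cocycles :: "nat \<Rightarrow> ('l list \<Rightarrow> 'm) set" where
  "expected_cocycles n =
     (if n = 0 then {f \<in> CL 0. f [] \<in> antisymmetric_kernel} else coboundaries n)"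

lemma subspace_coboundaries: "C.subspace (coboundaries n)"
proof (cases n)
  case (Suc k)
  have "module_hom scaleCL scaleCL (coboundary k)"
    by unfold_locales (simp_all add: coboundary_add coboundary_scale)
  then show ?thesis
    using module_hom.subspace_image[OF _ subspace_CL] Suc by (simp add: coboundaries_def)
qed (simp add: coboundaries_def)

lemma expected_cocycles_add:
  assumes "f \<in> expected_cocycles n" "g \<in> expected_cocycles n"
  shows "f + g \<in> expected_cocycles n"
proof (cases n)
  case 0
  have "M.subspace antisymmetric_kernel"
    by (simp add: antisymmetric_kernel_def)
  then show ?thesis
    using assms 0 C.subspace_add[OF subspace_CL] M.subspace_add
    by (simp add: expected_cocycles_def)
next
  case (Suc k)
  then show ?thesis
    using assms C.subspace_add[OF subspace_coboundaries] by (simp add: expected_cocycles_def)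
qed

text \<open>In positive degree this is Cartan's formula. In degree 0 the value of a cocycle is
  killed from the right, so adding the zero term \<open>ract (w []) x\<close> to its left translate
  exhibits a generator of the anti-symmetric kernel.\<close>

lemma lie_derivative_cocycle_expected:
  assumes "w \<in> cocycles n"
  shows "lie_derivative x w \<in> expected_cocycles n"
proof (cases n)
  case 0
  have "ract (w []) x = 0"
    using assms 0 coboundary_0_eq_zero_iff by (simp add: cocycles_def)
  then have "lie_derivative x w [] = lact x (w []) + ract (w []) x"
    by (simp add: lie_derivative_def)
  then have "lie_derivative x w [] \<in> antisymmetric_kernel"
    unfolding antisymmetric_kernel_def by (auto intro: M.span_base)
  then show ?thesis
    using assms 0 by (simp add: expected_cocycles_def cocycles_def lie_derivative_CL)
next
  case (Suc k)
  then show ?thesis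
    using assms lie_derivative_cocycle_coboundary[of w k x] contraction_CL[of w k x]
    by (auto simp: expected_cocycles_def coboundaries_def cocycles_def)
qed

text \<open>Induction on the index of a term of a composition series that contains all values of the
  cocycle. Subtracting a suitable Lie derivative moves the values one term down, and what is
  subtracted is itself an expected cocycle.\<close>

theorem cocycles_subset_expected:
  assumes fdL: "finite_dimensional_vector_space scaleL BL"
    and fdM: "finite_dimensional_vector_space scaleM BM"
    and nilpotent: "L.nilpotent"
    and nontrivial: "\<forall>Q\<in>composition_factors. \<not> trivial_bimodule Q"
  shows "cocycles n \<subseteq> expected_cocycles n"
proof -
  obtain Us where Us: "composition_series Us"
    using composition_series_of_subbimodule[OF fdM, of UNIV]
    by (auto simp: composition_series_def subbimodule_iff)
  obtain T where T: "finite T" "CL n \<subseteq> C.span T"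
    using CL_finite_span[of BL BM n] fdL fdM
    by (auto simp: finite_dimensional_vector_space_def finite_dimensional_vector_space_axioms_def)
  have main: "f \<in> expected_cocycles n"
    if "i < length Us" "f \<in> cocycles n" "\<And>ys. f ys \<in> Us ! i" for i f
    using that
  proof (induction i arbitrary: f)
    case 0
    then have "f = 0"
      using Us by (auto simp: composition_series_def hd_conv_nth fun_eq_iff)
    moreover have "0 \<in> expected_cocycles n"
      using C.subspace_0[OF subspace_CL] C.subspace_0[OF subspace_coboundaries]
      by (simp add: expected_cocycles_def antisymmetric_kernel_def M.span_zero)
    ultimately show ?case by (simp only:)
  next
    case (Suc i)
    let ?U = "Us ! Suc i" and ?V = "Us ! i"
    have UV: "subbimodule ?U" "subbimodule ?V" "?V \<subseteq> ?U"
      "simple_bimodule (quotient_bimodule ?U ?V)"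
      using Us Suc.prems(1) by (auto simp: composition_series_def)
    have "quotient_bimodule ?U ?V \<in> composition_factors"
      using Us Suc.prems(1) unfolding composition_factors_def by blast
    then obtain x where x: "\<And>u. u \<in> ?U \<Longrightarrow> lact x u \<in> ?V \<Longrightarrow> u \<in> ?V"
      using nontrivial_simple_has_injective_action[OF nilpotent UV] nontrivial by blast
    have actU: "\<And>u. u \<in> ?U \<Longrightarrow> lact x u \<in> ?U"
      using UV(1) by (simp add: subbimodule_iff)
    obtain w where w: "w \<in> cocycles n" "\<And>ys. (f - lie_derivative x w) ys \<in> ?V"
      using cocycle_push_down[OF T subbimodule_subspace[OF UV(1)] actU
          subbimodule_subspace[OF UV(2)] x left_multiplication_nilpotent[OF nilpotent]
          Suc.prems(2,3)] by blast
    have "f - lie_derivative x w \<in> cocycles n"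
      using C.subspace_diff[OF subspace_cocycles] Suc.prems(2) lie_derivative_cocycles w(1) by blast
    then have "f - lie_derivative x w \<in> expected_cocycles n"
      using Suc w(2) by simp
    then show ?case
      using expected_cocycles_add lie_derivative_cocycle_expected[OF w(1), of x] by fastforce
  qed
  show ?thesis
  proof
    fix f assume f: "f \<in> cocycles n"
    have "Us \<noteq> []" "last Us = UNIV"
      using Us by (auto simp: composition_series_def)
    then show "f \<in> expected_cocycles n"
      using main[of "length Us - 1" f] f by (simp add: last_conv_nth)
  qed
qed

section \<open>From cocycles to the cohomology spaces\<close>

lemma HL_zero:
  assumes "cocycles n \<subseteq> coboundaries n"
  shows "vs_carrier (HL n) = {vs_zero (HL n)}"
proof -
  have "f +o coboundaries n = coboundaries n" if "f \<in> cocycles n" for f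
    using coset_eq_iff[of "coboundaries n" f 0] that assms
      C.subspace_0[OF subspace_coboundaries] C.subspace_add[OF subspace_coboundaries]
      C.subspace_neg[OF subspace_coboundaries] by auto
  then show ?thesis
    using C.subspace_0[OF subspace_cocycles]
    by (auto simp: HL_def quotient_vspace_def)
qed

lemma vspace_iso_zero:
  assumes "vs_carrier W = {vs_zero W}"
  shows "vspace_iso W (subspace_vspace scaleM {0})"
  unfolding vspace_iso_def subspace_vspace_def
  by (intro exI[of _ "\<lambda>_. 0"]) (simp add: assms bij_betw_def)

text \<open>The coboundaries of degree 0 are \<open>{0}\<close>, so every coset is a singleton,
  which \<open>the_elem\<close> opens; a cochain of degree 0 is determined by its value at the empty
  list.\<close>

lemma HL_0_iso:
  assumes cocycles_0: "cocycles 0 = {f \<in> CL 0. f [] \<in> N}"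
  shows "vspace_iso (HL 0) (subspace_vspace scaleM N)"
proof -
  have HL: "vs_carrier (HL 0) = (\<lambda>f. {f}) ` cocycles 0" "vs_add (HL 0) = (+)"
    "vs_scale (HL 0) c {f} = {scaleCL c f}" for c f
    by (auto simp: HL_def quotient_vspace_def coboundaries_def elt_set_plus_def)
  have add: "{f} + {g} = {f + g}" for f g :: "'l list \<Rightarrow> 'm"
    by (simp add: set_plus_def)
  have inj: "f = g" if "f \<in> CL 0" "g \<in> CL 0" "f [] = g []" for f g
    using that by (metis CL_outside ext length_0_conv)
  have surj: "\<exists>f\<in>cocycles 0. f [] = m" if "m \<in> N" for m
    using that cocycles_0 by (intro bexI[of _ "\<lambda>xs. if xs = [] then m else 0"]) (simp_all add: CL_def)
  have "bij_betw (\<lambda>S. the_elem S []) (vs_carrier (HL 0)) N"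
    unfolding bij_betw_def inj_on_def HL(1) image_image
    using inj surj cocycles_0 by (fastforce simp: image_iff)
  then show ?thesis
    unfolding vspace_iso_def
    by (intro exI[of _ "\<lambda>S. the_elem S []"])
      (auto simp: HL add subspace_vspace_def scaleCL_apply)
qed

end

theorem theorem4p2:
  fixes scaleL :: "'f::field \<Rightarrow> 'l::ab_group_add \<Rightarrow> 'l"
    and mult :: "'l \<Rightarrow> 'l \<Rightarrow> 'l"
    and scaleM :: "'f \<Rightarrow> 'm::ab_group_add \<Rightarrow> 'm"
    and lact :: "'l \<Rightarrow> 'm \<Rightarrow> 'm"
    and ract :: "'m \<Rightarrow> 'l \<Rightarrow> 'm"
  assumes "leibniz_bimodule scaleL mult scaleM lact ract"
    and "\<exists>B. finite_dimensional_vector_space scaleL B"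
    and "leibniz_algebra.nilpotent mult"
    and "\<exists>B. finite_dimensional_vector_space scaleM B"
    and "\<forall>Q \<in> leibniz_bimodule.composition_factors scaleM lact ract. \<not> trivial_bimodule Q"
  shows "(\<forall>n. vspace_iso (leibniz_bimodule.HL scaleL mult scaleM lact ract n)
            (subspace_vspace scaleM
              (if n = 0 then leibniz_bimodule.antisymmetric_kernel scaleM lact ract else {0}))) \<and>
         (leibniz_bimodule.symmetric lact ract \<longrightarrow>
           (\<forall>n. vspace_is_zero (leibniz_bimodule.HL scaleL mult scaleM lact ract n)))"
proof -
  interpret leibniz_bimodule scaleL mult scaleM lact ract by (fact assms(1))
  have expected: "cocycles n \<subseteq> expected_cocycles n" for n
    using assms(2-5) cocycles_subset_expected by blast
  have positive: "vs_carrier (HL n) = {vs_zero (HL n)}" if "n \<noteq> 0" for n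
    using expected[of n] that by (intro HL_zero) (simp add: expected_cocycles_def)
  \<comment> \<open>One inclusion is the result of the descent; the other holds because the right
    action kills the anti-symmetric kernel.\<close>
  have cocycles_0: "cocycles 0 = {f \<in> CL 0. f [] \<in> antisymmetric_kernel}"
    using expected[of 0] ract_antisymmetric_kernel
    by (auto simp: expected_cocycles_def cocycles_def coboundary_0_eq_zero_iff)
  show ?thesis
  proof (intro conjI allI impI)
    fix n
    show "vspace_iso (HL n) (subspace_vspace scaleM (if n = 0 then antisymmetric_kernel else {0}))"
      using HL_0_iso[OF cocycles_0] vspace_iso_zero[OF positive[of n]]
      by (cases "n = 0") auto
  next
    fix n assume "symmetric"
    then have "{lact x m + ract m x |x m. True} = {0}"
      by (auto simp: symmetric_def)
    then have "antisymmetric_kernel = {0}"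
      by (simp add: antisymmetric_kernel_def)
    then have "cocycles 0 \<subseteq> coboundaries 0"
      unfolding cocycles_0 coboundaries_def by (auto simp: fun_eq_iff dest: CL_outside)
        (metis CL_outside length_0_conv)
    then show "vspace_is_zero (HL n)"
      using positive[of n] HL_zero[of 0] by (cases "n = 0") (simp_all add: vspace_is_zero_def)
  qed
qed

end
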